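(* Let $P$ be the torsion-free group defined by the presentation $\langle a, b \mid b^{-1} a^2 b = a^{-2},\ a^{-1} b^2 a = b^{-2} \rangle$ and set $x = a^2$, $y = b^2$, $z = (ab)^2$ in $P$. In the group ring $\mathbb{F}_2[P]$ set \begin{align*} p &= (1 + x)(1 + y)(1 + z^{-1}), \\ q &= x^{-1} y^{-1} + x + y^{-1} z + z, \\ r &= 1 + x + y^{-1} z + xyz, \\ s &= 1 + (x + x^{-1} + y + y^{-1}) z^{-1}. \end{align*} Then $p + qa + rb + sab$ is a non-trivial unit in the group ring $\mathbb{F}_2[P]$.
   Context: $\mathbb{F}_2$ is the field with two elements. For a field $K$ and a group $G$, a trivial unit of the group ring $K[G]$ is an element of the form $kg$ with $k \in K \setminus \{0\}$ and $g \in G$; a non-trivial unit is a (two-sided) unit of $K[G]$ that is not a trivial unit. Here $sab$ denotes the product $s \cdot a \cdot b$ in $\mathbb{F}_2[P]$, and similarly for $qa$ and $rb$. *)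

theory Defs
  imports "HOL-Library.Poly_Mapping" "HOL-Library.Z2"
begin

(* A word over a set of generators: the letter (g, True) stands for g and (g, False) for the
   formal inverse of g. *)
type_synonym 'x word = "('x \<times> bool) list"

(* Equality in the group presented by the relations u = v, (u, v) \<in> R: the least congruence on
   words that contains R and identifies each g g^{-1} and each g^{-1} g with the empty word. *)
inductive pres_eq :: "('x word \<times> 'x word) set \<Rightarrow> 'x word \<Rightarrow> 'x word \<Rightarrow> bool" for R where
  refl: "pres_eq R u u"
| sym: "pres_eq R u v \<Longrightarrow> pres_eq R v u"
| trans: "pres_eq R u v \<Longrightarrow> pres_eq R v w \<Longrightarrow> pres_eq R u w"
| append: "pres_eq R u u' \<Longrightarrow> pres_eq R v v' \<Longrightarrow> pres_eq R (u @ v) (u' @ v')"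
| cancel: "pres_eq R [(g, e), (g, \<not> e)] []"
| relation: "(u, v) \<in> R \<Longrightarrow> pres_eq R u v"

lemma equivp_pres_eq: "equivp (pres_eq R)"
  by (rule equivpI) (auto simp: reflp_def symp_def transp_def intro: pres_eq.intros)

definition inv_word :: "'x word \<Rightarrow> 'x word" where
  "inv_word u = rev (map (\<lambda>(g, e). (g, \<not> e)) u)"

lemma inv_word_simps [simp]:
  "inv_word [] = []"
  "inv_word ((g, e) # u) = inv_word u @ [(g, \<not> e)]"
  by (simp_all add: inv_word_def)

lemma pres_eq_inv_word_left: "pres_eq R (inv_word u @ u) []"
proof (induction u)
  case Nil
  show ?case by (simp add: pres_eq.refl)
next
  case (Cons l u)
  obtain g e where l: "l = (g, e)" by fastforce
  have "pres_eq R ([(g, \<not> e)] @ [(g, e)]) []"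
    using pres_eq.cancel[of R g "\<not> e"] by simp
  then have "pres_eq R (inv_word u @ (([(g, \<not> e)] @ [(g, e)]) @ u)) (inv_word u @ ([] @ u))"
    by (intro pres_eq.append pres_eq.refl)
  then show ?case using Cons.IH l by (auto intro: pres_eq.trans)
qed

lemma pres_eq_inv_word_right: "pres_eq R (u @ inv_word u) []"
proof -
  have "inv_word (inv_word u) = u"
    by (induction u) (auto simp: inv_word_def)
  then show ?thesis using pres_eq_inv_word_left[of R "inv_word u"] by simp
qed

lemma pres_eq_inv_word:
  assumes "pres_eq R u v"
  shows "pres_eq R (inv_word u) (inv_word v)"
proof -
  have "pres_eq R (inv_word u @ (v @ inv_word v)) (inv_word u @ [])"
    by (intro pres_eq.append pres_eq.refl pres_eq_inv_word_right)
  then have 1: "pres_eq R (inv_word u) ((inv_word u @ v) @ inv_word v)"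
    by (simp add: pres_eq.sym)
  have "pres_eq R (inv_word u @ v) (inv_word u @ u)"
    by (intro pres_eq.append pres_eq.refl pres_eq.sym[OF assms])
  then have "pres_eq R (inv_word u @ v) []"
    using pres_eq_inv_word_left pres_eq.trans by blast
  then have "pres_eq R ((inv_word u @ v) @ inv_word v) ([] @ inv_word v)"
    by (intro pres_eq.append pres_eq.refl)
  with 1 show ?thesis by (auto intro: pres_eq.trans)
qed

datatype gen = Gen_a | Gen_b

(* b^{-1} a^2 b = a^{-2} and a^{-1} b^2 a = b^{-2} *)
definition P_relations :: "(gen word \<times> gen word) set" where
  "P_relations =
    {([(Gen_b, False), (Gen_a, True), (Gen_a, True), (Gen_b, True)],
      [(Gen_a, False), (Gen_a, False)]),
     ([(Gen_a, False), (Gen_b, True), (Gen_b, True), (Gen_a, True)],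
      [(Gen_b, False), (Gen_b, False)])}"

(* The non-abelian group P is written additively, since convolution on \<Rightarrow>\<^sub>0 is defined for an
   additive monoid of exponents: g + h, 0 and - g are the product, the identity and the inverse. *)
quotient_type P = "gen word" / "pres_eq P_relations"
  by (rule equivp_pres_eq)

instantiation P :: group_add
begin

lift_definition zero_P :: P is "[]" .

lift_definition plus_P :: "P \<Rightarrow> P \<Rightarrow> P" is "(@)"
  by (rule pres_eq.append)

lift_definition uminus_P :: "P \<Rightarrow> P" is inv_word
  by (rule pres_eq_inv_word)

definition minus_P :: "P \<Rightarrow> P \<Rightarrow> P" where
  "minus_P g h = g + - h"

instance
proof
  fix g h k :: P
  show "g + h + k = g + (h + k)" by transfer (simp add: pres_eq.refl)
  show "0 + g = g" by transfer (simp add: pres_eq.refl)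
  show "g + 0 = g" by transfer (simp add: pres_eq.refl)
  show "- g + g = 0" by transfer (rule pres_eq_inv_word_left)
  show "g + - h = g - h" by (simp add: minus_P_def)
qed

end

lift_definition gen_a :: P is "[(Gen_a, True)]" .

lift_definition gen_b :: P is "[(Gen_b, True)]" .

definition torsion_free :: "'g::group_add itself \<Rightarrow> bool" where
  "torsion_free _ \<longleftrightarrow>
    (\<forall>(g::'g) (n::nat). n > 0 \<longrightarrow> sum_list (replicate n g) = 0 \<longrightarrow> g = 0)"

(* The group ring K[G] is the type 'g \<Rightarrow>\<^sub>0 'k of finitely supported functions with convolution. *)

definition two_sided_unit :: "'r::ring_1 \<Rightarrow> bool" where
  "two_sided_unit u \<longleftrightarrow> (\<exists>v. u * v = 1 \<and> v * u = 1)"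

definition trivial_unit :: "('g::group_add \<Rightarrow>\<^sub>0 'k::field) \<Rightarrow> bool" where
  "trivial_unit u \<longleftrightarrow> (\<exists>k g. k \<noteq> 0 \<and> u = Poly_Mapping.single g k)"

definition nontrivial_unit :: "('g::group_add \<Rightarrow>\<^sub>0 'k::field) \<Rightarrow> bool" where
  "nontrivial_unit u \<longleftrightarrow> two_sided_unit u \<and> \<not> trivial_unit u"

(* The type bit of HOL-Library is the field with two elements. *)
definition of_P :: "P \<Rightarrow> (P \<Rightarrow>\<^sub>0 bit)" where
  "of_P g = Poly_Mapping.single g 1"

end

(* P is an extension of the free abelian group on x, y, z by the Klein four-group, so every
   element has the form x^i y^j z^k a^e b^f with e, f in {0, 1}. The left multiplications by a and b
   on the exponents (i, j, k, e, f) are permutations that satisfy the relations of P; the resulting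
   action of P on exponents shows that normal forms are unique. The square of every element is a
   translation (i, j, k), which vanishes only for the neutral element, whence P is torsion-free.
   With w^a = a^{-1} w a, the inverse of p + q a + r b + s a b is
   x^{-1} p^a + x^{-1} q a + y^{-1} r b + z^{-1} s^a a b (Gardam),
   and the two products are computed on normal forms. *)
theory Submission
  imports Defs
begin

section \<open>Integer multiples in a non-commutative additive group\<close>

definition zmult :: "int \<Rightarrow> 'g::group_add \<Rightarrow> 'g" where
  "zmult i g = (if i \<ge> 0 then sum_list (replicate (nat i) g) else sum_list (replicate (nat (- i)) (- g)))"

lemma zmult_0 [simp]: "zmult 0 g = 0"
  by (simp add: zmult_def)

lemma zmult_1 [simp]: "zmult 1 g = g"
  by (simp add: zmult_def)

lemma zmult_succ: "zmult (i + 1) g = g + zmult i g"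
proof (cases "i \<ge> 0")
  case True
  then show ?thesis by (simp add: zmult_def nat_add_distrib)
next
  case False
  then have "nat (- i) = Suc (nat (- (i + 1)))" by simp
  with False show ?thesis by (cases "i = -1") (simp_all add: zmult_def flip: add.assoc)
qed

lemma zmult_pred: "zmult (i - 1) g = - g + zmult i g"
  using zmult_succ[of "i - 1" g] by (simp flip: add.assoc)

lemma zmult_add: "zmult (i + j) g = zmult i g + zmult j g"
proof (induction i rule: int_induct[where k = 0])
  case (step1 i)
  then show ?case using zmult_succ[of "i + j" g] zmult_succ[of i g] by (simp add: ac_simps)
next
  case (step2 i)
  then show ?case using zmult_pred[of "i + j" g] zmult_pred[of i g]
    by (simp add: algebra_simps)
qed simp

text \<open>Conjugation by \<open>h\<close> is a homomorphism, so it carries powers of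
  \<open>g\<close> to powers of \<open>g'\<close>.\<close>

lemma zmult_intertwine:
  assumes "h + g = g' + h"
  shows "h + zmult i g = zmult i g' + h"
proof (induction i rule: int_induct[where k = 0])
  case (step1 i)
  have "h + zmult (i + 1) g = (h + g) + zmult i g"
    by (simp add: zmult_succ add.assoc)
  also have "\<dots> = g' + (h + zmult i g)"
    by (simp add: assms add.assoc)
  finally show ?case by (simp add: step1 zmult_succ add.assoc)
next
  case (step2 i)
  have "h + - g = - g' + h"
    using assms by (metis add.assoc add.right_inverse add_0_right minus_add_cancel)
  then have "h + zmult (i - 1) g = (- g' + h) + zmult i g"
    by (simp add: zmult_pred flip: add.assoc)
  then show ?case by (simp add: step2 zmult_pred add.assoc)
qed simp

lemma zmult_minus: "zmult i (- g) = zmult (- i) g"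
proof (induction i rule: int_induct[where k = 0])
  case (step1 i)
  moreover have "- (i + 1) = - i - 1" by simp
  ultimately show ?case by (simp only: zmult_succ zmult_pred)
next
  case (step2 i)
  moreover have "- (i - 1) = - i + 1" by simp
  ultimately show ?case by (simp only: zmult_succ zmult_pred minus_minus)
qed simp

section \<open>The action on exponents\<close>

text \<open>\<open>(i, j, k, e, f)\<close> encodes \<open>x^i y^j z^k a^e b^f\<close>.\<close>

type_synonym exps = "int \<times> int \<times> int \<times> bool \<times> bool"

fun act_a :: "exps \<Rightarrow> exps" where
  "act_a (i, j, k, e, f) = (if e then i + 1 else i, - j, - k, \<not> e, f)"

fun act_a_inv :: "exps \<Rightarrow> exps" where
  "act_a_inv (i, j, k, e, f) = (if e then i else i - 1, - j, - k, \<not> e, f)"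

text \<open>For \<open>e = 1\<close> this uses \<open>b a = x^{-1} y z^{-1} a b\<close>.\<close>

fun act_b :: "exps \<Rightarrow> exps" where
  "act_b (i, j, k, e, f) =
    (if e then (- i - 1, if f then j else j + 1, - k - 1, e, \<not> f)
     else (- i, if f then j + 1 else j, - k, e, \<not> f))"

fun act_b_inv :: "exps \<Rightarrow> exps" where
  "act_b_inv (i, j, k, e, f) =
    (if e then (- i - 1, if f then j - 1 else j, - k - 1, e, \<not> f)
     else (- i, if f then j else j - 1, - k, e, \<not> f))"

lemma act_inverse [simp]:
  "act_a (act_a_inv t) = t" "act_a_inv (act_a t) = t"
  "act_b (act_b_inv t) = t" "act_b_inv (act_b t) = t"
  by (cases t; simp)+

fun act_letter :: "gen \<times> bool \<Rightarrow> exps \<Rightarrow> exps" where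
  "act_letter (Gen_a, True) = act_a"
| "act_letter (Gen_a, False) = act_a_inv"
| "act_letter (Gen_b, True) = act_b"
| "act_letter (Gen_b, False) = act_b_inv"

lemma act_letter_cancel: "act_letter (g, e) (act_letter (g, \<not> e) t) = t"
  by (cases g; cases e) simp_all

text \<open>Opposite letters act as mutually inverse permutations, and both relations hold for these
  permutations by computation on exponents; hence the action descends to \<open>P\<close>.\<close>

lemma act_word_cong:
  assumes "pres_eq P_relations u v"
  shows "foldr act_letter u = foldr act_letter v"
  using assms
proof induction
  case (cancel g e)
  show ?case by (simp add: fun_eq_iff act_letter_cancel)
next
  case (relation u v)
  then show ?case by (auto simp: P_relations_def fun_eq_iff)
qed simp_all

lift_definition act :: "P \<Rightarrow> exps \<Rightarrow> exps" is "foldr act_letter"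
  by (rule act_word_cong)

lemma act_0 [simp]: "act 0 t = t"
  by transfer simp

lemma act_add [simp]: "act (g + h) t = act g (act h t)"
  by transfer simp

lemma act_gen [simp]: "act gen_a = act_a" "act gen_b = act_b"
  by (transfer, simp)+

text \<open>Serves for the powers of x, y, z in a normal form and for the powers of a square in
  torsion-freeness.\<close>

lemma act_zmult_shift:
  assumes shift: "\<And>i j k e f. act g (i, j, k, e, f) = (i + i', j + j', k + k', e, f)"
  shows "act (zmult n g) (i, j, k, e, f) = (i + n * i', j + n * j', k + n * k', e, f)"
proof -
  have inv: "act (- g) (i, j, k, e, f) = (i - i', j - j', k - k', e, f)" for i j k e f
    using act_add[of "- g" g "(i - i', j - j', k - k', e, f)"] by (simp add: shift del: act_add)
  show ?thesis
    by (induction n rule: int_induct[where k = 0])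
      (simp_all add: zmult_succ zmult_pred shift inv algebra_simps)
qed

section \<open>Normal forms\<close>

definition gen_x :: P where "gen_x = gen_a + gen_a"
definition gen_y :: P where "gen_y = gen_b + gen_b"
definition gen_z :: P where "gen_z = (gen_a + gen_b) + (gen_a + gen_b)"

fun of_exps :: "exps \<Rightarrow> P" where
  "of_exps (i, j, k, e, f) =
    zmult i gen_x + zmult j gen_y + zmult k gen_z + (if e then gen_a else 0) + (if f then gen_b else 0)"

text \<open>Rewrite rules that move \<open>h\<close> to the right; the second form acts inside
  right-nested sums.\<close>

lemma zmult_push:
  assumes "h + g = g' + h"
  shows "h + zmult i g = zmult i g' + h" "h + (zmult i g + u) = zmult i g' + (h + u)"
  using zmult_intertwine[OF assms, of i] by (simp_all flip: add.assoc)

lemma zmult_push_neg: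
  fixes h g :: "'g::group_add"
  assumes "h + - g = g + h"
  shows "h + zmult i g = zmult (- i) g + h" "h + (zmult i g + u) = zmult (- i) g + (h + u)"
proof -
  show "h + zmult i g = zmult (- i) g + h"
    using zmult_intertwine[OF assms, of "- i"] by (simp add: zmult_minus)
  then show "h + (zmult i g + u) = zmult (- i) g + (h + u)"
    by (simp flip: add.assoc)
qed

text \<open>Conjugation by \<open>h\<close> inverts \<open>g\<close>, so conjugation by the square
  of \<open>h\<close> fixes \<open>g\<close>. This makes x, y, z commute.\<close>

lemma double_commute:
  fixes h g :: "'g::group_add"
  assumes "h + - g = g + h"
  shows "g + (h + h) = (h + h) + g"
proof -
  have "h = (g + h) + g"
    using assms by (simp only: add_uminus_conv_diff diff_eq_eq)
  then have "- g + h = - g + ((g + h) + g)" by (rule arg_cong)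
  then have "h + g = - g + h" by (simp only: add.assoc minus_add_cancel)
  then have "h + (h + g) = (h + - g) + h" by (simp only: add.assoc)
  then show ?thesis using assms by (simp only: add.assoc)
qed

section \<open>Conjugation of x, y, z by a and b\<close>

lemma b_x: "gen_b + - gen_x = gen_x + gen_b"
proof -
  have "- gen_b + gen_x + gen_b = - gen_x"
    unfolding gen_x_def by transfer (auto simp: P_relations_def intro!: pres_eq.relation)
  from this[symmetric] show ?thesis by (simp flip: add.assoc)
qed

lemma a_y: "gen_a + - gen_y = gen_y + gen_a"
proof -
  have "- gen_a + gen_y + gen_a = - gen_y"
    unfolding gen_y_def by transfer (auto simp: P_relations_def intro!: pres_eq.relation)
  from this[symmetric] show ?thesis by (simp flip: add.assoc)
qed

lemma a_x: "gen_a + gen_x = gen_x + gen_a"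
  by (simp add: gen_x_def add.assoc)

lemma b_y: "gen_b + gen_y = gen_y + gen_b"
  by (simp add: gen_y_def add.assoc)

lemmas push_xy = zmult_push[OF a_x] zmult_push_neg[OF a_y] zmult_push_neg[OF b_x] zmult_push[OF b_y]

lemma y_x: "gen_y + gen_x = gen_x + gen_y"
  using double_commute[OF a_y] by (simp add: gen_x_def)

text \<open>The exponent 1 stays explicit so that \<open>zmult_collect\<close> can merge it with
  neighbouring powers.\<close>

lemma squares:
  "gen_a + gen_a = zmult 1 gen_x" "gen_a + (gen_a + u) = zmult 1 gen_x + u"
  "gen_b + gen_b = zmult 1 gen_y" "gen_b + (gen_b + u) = zmult 1 gen_y + u"
  by (simp_all add: gen_x_def gen_y_def add.assoc)

lemma zmult_collect:
  "zmult i g + zmult j g = zmult (i + j) g" "zmult i g + (zmult j g + u) = zmult (i + j) g + u"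
  by (simp_all add: zmult_add add.assoc)

lemma zmult_commute:
  assumes "h + g = g + h"
  shows "zmult i h + zmult j g = zmult j g + zmult i h"
    "zmult i h + (zmult j g + u) = zmult j g + (zmult i h + u)"
proof -
  from zmult_intertwine[OF assms] have "g + zmult i h = zmult i h + g"
    using zmult_intertwine[of g h h i] assms by simp
  then show "zmult i h + zmult j g = zmult j g + zmult i h"
    using zmult_intertwine[of "zmult i h" g g j] by simp
  then show "zmult i h + (zmult j g + u) = zmult j g + (zmult i h + u)"
    by (simp flip: add.assoc)
qed

text \<open>In (ba)^2 (ab)^2 the inner letters form squares, which move to the left and cancel.
  Regrouping a (ba)^2 = (ab)^2 a then shows that a inverts z; similarly for b.\<close>

lemma b_a_b_a: "gen_b + (gen_a + (gen_b + gen_a)) = - gen_z"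
proof -
  have "gen_b + (gen_a + (gen_b + gen_a)) + gen_z = 0"
    by (simp only: gen_z_def add.assoc squares push_xy zmult_commute[OF y_x] zmult_collect) simp
  then show ?thesis by (simp add: eq_neg_iff_add_eq_0)
qed

lemma a_z: "gen_a + - gen_z = gen_z + gen_a"
  unfolding b_a_b_a[symmetric] by (simp add: gen_z_def add.assoc)

lemma b_z: "gen_b + - gen_z = gen_z + gen_b"
proof -
  have "gen_b + gen_z = - gen_z + gen_b"
    unfolding b_a_b_a[symmetric] by (simp add: gen_z_def add.assoc)
  then have "gen_z + (gen_b + gen_z) = gen_b" by (simp flip: add.assoc)
  then have "gen_z + gen_b = gen_b - gen_z" by (simp only: eq_diff_eq add.assoc)
  then show ?thesis by simp
qed

lemmas push = push_xy zmult_push_neg[OF a_z] zmult_push_neg[OF b_z]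

lemma z_x: "gen_z + gen_x = gen_x + gen_z"
  using double_commute[OF a_z] by (simp add: gen_x_def)

lemma z_y: "gen_z + gen_y = gen_y + gen_z"
  using double_commute[OF b_z] by (simp add: gen_y_def)

lemmas commute = zmult_commute[OF y_x] zmult_commute[OF z_x] zmult_commute[OF z_y]

text \<open>With (ba)^2 in place of z^{-1}, the factor (ba)^2 ab collapses to x y^{-1} ba.\<close>

lemma b_a: "gen_b + gen_a = zmult (-1) gen_x + (zmult 1 gen_y + (zmult (-1) gen_z + (gen_a + gen_b)))"
proof -
  have "zmult (-1) gen_z = gen_b + (gen_a + (gen_b + gen_a))"
    by (simp add: b_a_b_a flip: zmult_minus)
  then show ?thesis
    by (simp only: add.assoc squares push_xy zmult_commute[OF y_x] zmult_collect) simp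
qed

lemma b_a_left:
  "gen_b + (gen_a + u) = zmult (-1) gen_x + (zmult 1 gen_y + (zmult (-1) gen_z + (gen_a + (gen_b + u))))"
  using arg_cong[OF b_a, of "\<lambda>v. v + u"] by (simp only: add.assoc)

lemmas normalize = add.assoc[where 'a = P] push commute squares zmult_collect b_a b_a_left

section \<open>Existence and uniqueness of normal forms\<close>

lemma of_exps_act_a: "of_exps (act_a t) = gen_a + of_exps t"
proof (cases t)
  case (fields i j k e f)
  show ?thesis
    unfolding fields by (cases e; cases f) (simp_all add: normalize del: zmult_1)
qed

lemma of_exps_act_b: "of_exps (act_b t) = gen_b + of_exps t"
proof (cases t)
  case (fields i j k e f)
  show ?thesis
    unfolding fields by (cases e; cases f) (simp_all add: normalize del: zmult_1)
qed

lemma of_exps_foldr: "of_exps (foldr act_letter w t) = abs_P w + of_exps t"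
proof (induction w)
  case Nil
  have "abs_P [] = 0" by (simp add: zero_P_def)
  then show ?case by simp
next
  case (Cons l w)
  obtain g e where l: "l = (g, e)" by fastforce
  have gen: "of_exps (act_letter (g, True) t) = abs_P [(g, True)] + of_exps t" for t
    by (cases g) (simp_all add: of_exps_act_a of_exps_act_b gen_a_def gen_b_def)
  have inv: "abs_P [(g, False)] = - abs_P [(g, True)]"
    by (simp add: uminus_P.abs_eq)
  have "of_exps (act_letter l t) = abs_P [l] + of_exps t" for t
  proof (cases e)
    case False
    \<comment> \<open>An inverse letter is reduced to the positive one, applied at the preimage of
      \<open>t\<close>.\<close>
    have "abs_P [(g, True)] + of_exps (act_letter (g, False) t) = of_exps t"
      using gen[of "act_letter (g, False) t"] act_letter_cancel[of g True t] by simp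
    then have "- abs_P [(g, True)] + (abs_P [(g, True)] + of_exps (act_letter (g, False) t)) =
        - abs_P [(g, True)] + of_exps t" by (rule arg_cong)
    then show ?thesis using False by (simp only: l inv minus_add_cancel)
  qed (simp add: l gen)
  moreover have "abs_P (l # w) = abs_P [l] + abs_P w"
    by (simp add: plus_P.abs_eq)
  ultimately show ?case using Cons.IH by (simp add: add.assoc)
qed

lemma of_exps_act: "of_exps (act g t) = g + of_exps t"
  by (induction g rule: P.abs_induct) (simp add: act.abs_eq of_exps_foldr)

abbreviation exps_0 :: exps where "exps_0 \<equiv> (0, 0, 0, False, False)"

lemma of_exps_surj: obtains t where "g = of_exps t"
proof
  show "g = of_exps (act g exps_0)" by (simp only: of_exps_act) simp
qed

text \<open>First a^e b^f acts, then x, y, z act as unit translations.\<close>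

lemma act_of_exps:
  "act (of_exps (i, j, k, e, f)) t =
    (case (if e then act_a else id) ((if f then act_b else id) t) of
      (i', j', k', e', f') \<Rightarrow> (i + i', j + j', k + k', e', f'))"
proof -
  have x: "act gen_x (i, j, k, e, f) = (i + 1, j + 0, k + 0, e, f)" for i j k e f
    by (simp add: gen_x_def)
  have y: "act gen_y (i, j, k, e, f) = (i + 0, j + 1, k + 0, e, f)" for i j k e f
    by (simp add: gen_y_def)
  have z: "act gen_z (i, j, k, e, f) = (i + 0, j + 0, k + 1, e, f)" for i j k e f
    by (simp add: gen_z_def)
  have gens: "act (if e then gen_a else 0) = (if e then act_a else id)"
    "act (if f then gen_b else 0) = (if f then act_b else id)"
    by (auto simp: fun_eq_iff)
  obtain i' j' k' e' f' where
    "(if e then act_a else id) ((if f then act_b else id) t) = (i', j', k', e', f')"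
    by (metis prod_cases5)
  then show ?thesis
    by (simp only: of_exps.simps act_add gens act_zmult_shift[OF x] act_zmult_shift[OF y]
        act_zmult_shift[OF z] prod.case) simp
qed

lemma of_exps_inject [simp]: "of_exps s = of_exps t \<longleftrightarrow> s = t"
proof -
  \<comment> \<open>Acting on the origin recovers the exponents.\<close>
  have "act (of_exps t) exps_0 = t" for t
    by (cases t) (auto simp: act_of_exps simp del: of_exps.simps)
  then show ?thesis by metis
qed

section \<open>Torsion-freeness\<close>

theorem P_torsion_free: "torsion_free TYPE(P)"
  unfolding torsion_free_def
proof (intro allI impI)
  fix g :: P and n :: nat
  assume n: "n > 0" and "sum_list (replicate n g) = 0"
  obtain i j k e f where g: "g = of_exps (i, j, k, e, f)"
    using of_exps_surj by (metis prod_cases5)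
  \<comment> \<open>The square is x^(2i+1), y^(2j+1) or z^(2k+1) in the coset of a, b or ab; an odd
    exponent cannot vanish.\<close>
  define i' j' k' where "i' = (if e then if f then 0 else 2 * i + 1 else if f then 0 else 2 * i)"
    and "j' = (if e then 0 else if f then 2 * j + 1 else 2 * j)"
    and "k' = (if e then if f then 2 * k + 1 else 0 else if f then 0 else 2 * k)"
  have square: "g + g = of_exps (i', j', k', False, False)"
    unfolding g i'_def j'_def k'_def of_exps_act[symmetric] act_of_exps by auto
  have shift: "act (g + g) (i, j, k, e, f) = (i + i', j + j', k + k', e, f)" for i j k e f
    unfolding square act_of_exps by simp
  \<comment> \<open>Doubling \<open>n\<close> gives a multiple of \<open>g + g\<close>, which acts
    as a translation even if \<open>g\<close> does not.\<close>
  have "sum_list (replicate (n + n) g) = 0"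
    using \<open>sum_list (replicate n g) = 0\<close> by (simp add: replicate_add)
  moreover have "sum_list (replicate (m + m) g) = zmult (int m) (g + g)" for m
    by (induction m) (simp_all add: zmult_succ[of "int _", simplified add.commute[of _ 1]] add.assoc)
  ultimately have "zmult (int n) (g + g) = 0" by metis
  with act_zmult_shift[OF shift, of "int n" 0 0 0 False False]
  have "i' = 0" "j' = 0" "k' = 0" using n by auto
  then have "\<not> e \<and> \<not> f \<and> i = 0 \<and> j = 0 \<and> k = 0"
    unfolding i'_def j'_def k'_def by (cases e; cases f; simp; presburger)
  then show "g = 0" by (simp add: g)
qed

section \<open>The group ring on lists of exponents\<close>

text \<open>The group law read off from \<open>act_of_exps\<close>, in executable form.\<close>

fun exps_mult :: "exps \<Rightarrow> exps \<Rightarrow> exps" where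
  "exps_mult (i, j, k, e, f) t =
    (case (if e then act_a else id) ((if f then act_b else id) t) of
      (i', j', k', e', f') \<Rightarrow> (i + i', j + j', k + k', e', f'))"

lemma of_exps_mult: "of_exps s + of_exps t = of_exps (exps_mult s t)"
  by (cases s) (simp only: exps_mult.simps of_exps_act flip: act_of_exps)

definition of_list :: "exps list \<Rightarrow> (P \<Rightarrow>\<^sub>0 bit)" where
  "of_list l = sum_list (map (\<lambda>t. of_P (of_exps t)) l)"

lemma of_list_append: "of_list l + of_list m = of_list (l @ m)"
  by (simp add: of_list_def)

definition list_mult :: "exps list \<Rightarrow> exps list \<Rightarrow> exps list" where
  "list_mult l m = concat (map (\<lambda>s. map (exps_mult s) m) l)"

lemma of_list_mult: "of_list l * of_list m = of_list (list_mult l m)"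
proof (induction l)
  case Nil
  show ?case by (simp add: of_list_def list_mult_def)
next
  case (Cons s l)
  have "of_P (of_exps s) * of_list m = of_list (map (exps_mult s) m)"
    by (induction m)
      (simp_all add: of_list_def distrib_left of_P_def mult_single of_exps_mult del: of_exps.simps)
  with Cons.IH show ?case
    by (simp add: of_list_def list_mult_def distrib_right)
qed

text \<open>Equal summands cancel in pairs because the coefficients have characteristic 2.\<close>

fun toggle :: "exps \<Rightarrow> exps list \<Rightarrow> exps list" where
  "toggle t [] = [t]"
| "toggle t (s # l) = (if s = t then l else s # toggle t l)"

lemma of_list_toggle: "of_list (toggle t l) = of_P (of_exps t) + of_list l"
proof (induction l)
  case (Cons s l)
  have "of_P g + (of_P g + u) = u" for g u
    by (simp add: of_P_def flip: add.assoc single_add)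
  with Cons show ?case by (simp add: of_list_def add.left_commute del: of_exps.simps)
qed (simp add: of_list_def)

lemma of_list_reduce: "of_list (foldr toggle l []) = of_list l"
  by (induction l) (simp_all add: of_list_toggle, simp_all add: of_list_def)

text \<open>Turns an identity in the group ring into a computation on exponents.\<close>

lemma of_list_eqI: "foldr toggle l [] = m \<Longrightarrow> of_list l = of_list m"
  using of_list_reduce by metis

text \<open>Distinct tuples are distinct group elements by \<open>of_exps_inject\<close>, so
  occurrences are counted modulo 2.\<close>

lemma lookup_of_list:
  "Poly_Mapping.lookup (of_list l) (of_exps t) = (\<Sum>s\<leftarrow>l. if s = t then 1 else 0)"
  by (induction l)
    (simp_all add: of_list_def of_P_def lookup_add lookup_single when_def del: of_exps.simps)

lemma of_list_basis:
  "of_P gen_a = of_list [(0, 0, 0, True, False)]"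
  "of_P gen_b = of_list [(0, 0, 0, False, True)]"
  "1 = of_list [(0, 0, 0, False, False)]"
  "of_P gen_x = of_list [(1, 0, 0, False, False)]"
  "of_P gen_y = of_list [(0, 1, 0, False, False)]"
  "of_P gen_z = of_list [(0, 0, 1, False, False)]"
  "of_P (- gen_x) = of_list [(-1, 0, 0, False, False)]"
  "of_P (- gen_y) = of_list [(0, -1, 0, False, False)]"
  "of_P (- gen_z) = of_list [(0, 0, -1, False, False)]"
  by (simp_all add: of_list_def of_P_def flip: zmult_minus)

section \<open>The unit and its inverse\<close>

theorem theorem1:
  fixes x y z :: P
    and a b X Y Z X' Y' Z' p q r s :: "P \<Rightarrow>\<^sub>0 bit"
  assumes "x = gen_a + gen_a"
    and "y = gen_b + gen_b"
    and "z = (gen_a + gen_b) + (gen_a + gen_b)"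
    and "a = of_P gen_a" and "b = of_P gen_b"
    and "X = of_P x" and "Y = of_P y" and "Z = of_P z"
    and "X' = of_P (- x)" and "Y' = of_P (- y)" and "Z' = of_P (- z)"
    and "p = (1 + X) * (1 + Y) * (1 + Z')"
    and "q = X' * Y' + X + Y' * Z + Z"
    and "r = 1 + X + Y' * Z + X * Y * Z"
    and "s = 1 + (X + X' + Y + Y') * Z'"
  shows "torsion_free TYPE(P) \<and> nontrivial_unit (p + q * a + r * b + s * a * b)"
proof
  show "torsion_free TYPE(P)" by (rule P_torsion_free)
  define u where "u = p + q * a + r * b + s * a * b"
  \<comment> \<open>Conjugation by a fixes x and inverts y and z; this turns \<open>p\<close> and
    \<open>s\<close> into the factors p^a and s^a written out here.\<close>
  define v where "v = X' * ((1 + X) * (1 + Y') * (1 + Z)) + X' * q * a + Y' * r * b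
    + Z' * (1 + (X + X' + Y + Y') * Z) * a * b"
  note to_list = assms[folded gen_x_def gen_y_def gen_z_def] of_list_basis of_list_append of_list_mult
  \<comment> \<open>Both factors have 21 terms; of the 441 products, all but one neutral element
    cancel in pairs.\<close>
  have "u * v = 1"
    unfolding u_def v_def to_list
    by (rule of_list_eqI) code_simp
  moreover have "v * u = 1"
    unfolding u_def v_def to_list
    by (rule of_list_eqI) code_simp
  moreover have "\<not> trivial_unit u"
  proof
    assume "trivial_unit u"
    then obtain g k where u: "u = Poly_Mapping.single g k"
      by (auto simp: trivial_unit_def)
    \<comment> \<open>Only \<open>p\<close> has terms free of a and b, and it contains both 1 and x,
      whereas a trivial unit is supported on one element.\<close>
    have "Poly_Mapping.lookup u (of_exps (0, 0, 0, False, False)) = 1"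
      "Poly_Mapping.lookup u (of_exps (1, 0, 0, False, False)) = 1"
      unfolding u_def to_list lookup_of_list by (simp_all add: list_mult_def)
    then have "g = of_exps (0, 0, 0, False, False)" "g = of_exps (1, 0, 0, False, False)"
      unfolding u lookup_single when_def by (metis zero_neq_one)+
    then show False by (simp del: of_exps.simps)
  qed
  ultimately show "nontrivial_unit (p + q * a + r * b + s * a * b)"
    unfolding nontrivial_unit_def two_sided_unit_def u_def by blast
qed

end
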